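(* Let $E$ be a real normed vector space, $\Omega\subset E$ a nonempty open set, $\hat{x}\in\Omega$, and let $(h_n)_{n\in\mathbb{N}}$ be a sequence of functions $h_n:\Omega\to\mathbb{R}$ satisfying property $(H)$ at $\hat{x}$, with limit function $h_\infty$. Then either (inclusive or) $$\Big\{ (x,t)\in \Omega\times [0,1]: \sup_{n\in \mathbb{N}} \big(h_n(x) - (1-t)h_n(\hat{x})\big) <0 \Big\}\neq \emptyset,$$ or there exists a sequence of real numbers $(\alpha_{\infty},\alpha_0,\alpha_1,\ldots)$ with $\alpha_{\infty}\geq 0$ and $\alpha_n\geq 0$ for all $n\in \mathbb{N}$ such that: (i) $\alpha_{\infty}+\sum_{n\geq 0} \alpha_n=1$; (ii) $\alpha_{\infty} h_{\infty}(\hat{x})+\sum_{n\geq 0} \alpha_{n}h_n(\hat{x})\geq 0$; (iii) $\alpha_{\infty} D^+h_{\infty}(\hat{x})(u)+\sum_{n\geq 0} \alpha_{n} D^+h_n(\hat{x})(u) \geq 0$ for all $u\in E$. In the second alternative, moreover: - if there exists $w\in E$ such that $\sup_{n\geq 1} D^+ h_n(\hat{x})(w) < 0$, then $\alpha_{0}\neq 0$; - if $h_n$ is Gateaux-differentiable at $\hat{x}$ for all $n\in \mathbb{N}$, then $\alpha_{\infty}\, d_G h_{\infty}(\hat{x})(u) + \sum_{n\geq 0} \alpha_{n}\, d_G h_n(\hat{x})(u)= 0$ for all $u\in E$.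
   Context: $\mathbb{N}=\{0,1,2,\ldots\}$. For $f$ real-valued near $x$, the upper Dini derivative at $x$ in direction $u\in E$ is $D^+ f(x)(u) :=\limsup_{t\to 0^+} \frac{f(x+tu)-f(x)}{t}$ (and $D^+f(x)(0)=0$). A function $p:E\to\mathbb{R}$ is sublinear if $p(x+y)\le p(x)+p(y)$ and $p(\lambda x)=\lambda p(x)$ for all $x,y\in E$ and real $\lambda\ge 0$. $f$ is Gateaux-differentiable at $x$ if there is a continuous linear functional $d_Gf(x)$ on $E$ with $\lim_{t\to 0}\frac{f(x+tu)-f(x)}{t}=d_Gf(x)(u)$ for all $u\in E$; then $D^+f(x)=d_Gf(x)$. Let $B(\hat{x},r)$ be the open ball of center $\hat{x}$ and radius $r\in(0,+\infty]$ (with $B(\hat x,+\infty)=E$). For a real-valued Lipschitz function $h$ on $B(\hat{x},r)\cap\Omega$ put $\|h\|_{\hat{x},r}=\sup_{x\ne y\in B(\hat{x},r)\cap\Omega}\frac{|h(x)-h(y)|}{\|x-y\|}$. Property $(H)$ at $\hat{x}$: there is $r\in(0,+\infty]$ such that every $h_n$ is Lipschitz on $B(\hat{x},r)\cap\Omega$, and: (i) $D^+h_n(\hat{x})$ is sublinear for all $n\in\mathbb{N}$; (ii) there exists a real-valued function $h_\infty$, Lipschitz on $B(\hat{x},r)\cap\Omega$, such that $h_\infty(\hat{x})=\lim_{n\to\infty}h_n(\hat{x})$ and $\|h_n-h_\infty\|_{\hat{x},r}\to 0$ as $n\to\infty$. When $(H)$ holds and all $h_n$ are Gateaux-differentiable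 at $\hat{x}$, so is $h_\infty$. *)

theory Defs
  imports "HOL-Analysis.Analysis"
begin

text \<open>
  The limsup is taken in the extended reals; it is finite whenever \<open>f\<close> is Lipschitz near \<open>x\<close>, the
  only situation in which the derivative is used, so \<^const>\<open>real_of_ereal\<close> loses nothing.
  For \<open>u = 0\<close> the value is \<open>0\<close>.
\<close>
definition upper_dini :: "('a::real_normed_vector \<Rightarrow> real) \<Rightarrow> 'a \<Rightarrow> 'a \<Rightarrow> real" where
  "upper_dini f x u =
     real_of_ereal (Limsup (at_right 0) (\<lambda>t::real. ereal ((f (x + t *\<^sub>R u) - f x) / t)))"

definition sublinear :: "('a::real_vector \<Rightarrow> real) \<Rightarrow> bool" where
  "sublinear p \<longleftrightarrow>
     (\<forall>x y. p (x + y) \<le> p x + p y) \<and> (\<forall>x. \<forall>c\<ge>0. p (c *\<^sub>R x) = c * p x)"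

definition has_gateaux_derivative ::
    "('a::real_normed_vector \<Rightarrow> real) \<Rightarrow> ('a \<Rightarrow> real) \<Rightarrow> 'a \<Rightarrow> bool" where
  "has_gateaux_derivative f D x \<longleftrightarrow>
     bounded_linear D \<and> (\<forall>u. ((\<lambda>t::real. (f (x + t *\<^sub>R u) - f x) / t) \<longlongrightarrow> D u) (at 0))"

definition gateaux_differentiable :: "('a::real_normed_vector \<Rightarrow> real) \<Rightarrow> 'a \<Rightarrow> bool" where
  "gateaux_differentiable f x \<longleftrightarrow> (\<exists>D. has_gateaux_derivative f D x)"

definition gateaux_derivative ::
    "('a::real_normed_vector \<Rightarrow> real) \<Rightarrow> 'a \<Rightarrow> 'a \<Rightarrow> real" where
  "gateaux_derivative f x = (THE D. has_gateaux_derivative f D x)"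

text \<open>Open balls whose radius may be \<open>\<infinity>\<close>, in which case the ball is the whole space.\<close>
definition eball :: "'a::metric_space \<Rightarrow> ereal \<Rightarrow> 'a set" where
  "eball x r = {y. ereal (dist x y) < r}"

text \<open>
  Valued in \<^typ>\<open>ennreal\<close>, so that the supremum is \<open>0\<close> when \<open>S\<close> has at most one point
  (which happens if the space is trivial).
\<close>
definition lip_seminorm :: "'a::real_normed_vector set \<Rightarrow> ('a \<Rightarrow> real) \<Rightarrow> ennreal" where
  "lip_seminorm S f =
     (SUP (x, y) \<in> {(x, y). x \<in> S \<and> y \<in> S \<and> x \<noteq> y}. ennreal (\<bar>f x - f y\<bar> / norm (x - y)))"

text \<open>
  Property (H) at \<open>xh\<close> for the sequence \<open>h\<close>, with limit function \<open>hinf\<close>. Functions on \<open>\<Omega>\<close> are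
  represented by total functions whose values outside \<open>\<Omega>\<close> play no role, and likewise for \<open>hinf\<close>
  outside the ball intersected with \<open>\<Omega>\<close>.
\<close>
definition property_H ::
    "'a::real_normed_vector set \<Rightarrow> 'a \<Rightarrow> (nat \<Rightarrow> 'a \<Rightarrow> real) \<Rightarrow> ('a \<Rightarrow> real) \<Rightarrow> bool" where
  "property_H \<Omega> xh h hinf \<longleftrightarrow>
     (\<exists>r::ereal. 0 < r \<and>
        (\<forall>n. \<exists>L. L-lipschitz_on (eball xh r \<inter> \<Omega>) (h n)) \<and>
        (\<forall>n. sublinear (upper_dini (h n) xh)) \<and>
        (\<exists>L. L-lipschitz_on (eball xh r \<inter> \<Omega>) hinf) \<and>
        (\<lambda>n. h n xh) \<longlonglongrightarrow> hinf xh \<and>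
        (\<lambda>n. lip_seminorm (eball xh r \<inter> \<Omega>) (\<lambda>x. h n x - hinf x)) \<longlonglongrightarrow> 0)"

text \<open>
  Convergence of each series is stated explicitly, because \<^const>\<open>suminf\<close> is total.
\<close>
definition multipliers ::
    "'a::real_normed_vector \<Rightarrow> (nat \<Rightarrow> 'a \<Rightarrow> real) \<Rightarrow> ('a \<Rightarrow> real) \<Rightarrow> real \<Rightarrow> (nat \<Rightarrow> real) \<Rightarrow> bool" where
  "multipliers xh h hinf \<alpha>inf \<alpha> \<longleftrightarrow>
     0 \<le> \<alpha>inf \<and> (\<forall>n. 0 \<le> \<alpha> n) \<and>
     (summable \<alpha> \<and> \<alpha>inf + (\<Sum>n. \<alpha> n) = 1) \<and>
     (summable (\<lambda>n. \<alpha> n * h n xh) \<and>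
        \<alpha>inf * hinf xh + (\<Sum>n. \<alpha> n * h n xh) \<ge> 0) \<and>
     (\<forall>u. summable (\<lambda>n. \<alpha> n * upper_dini (h n) xh u) \<and>
        \<alpha>inf * upper_dini hinf xh u + (\<Sum>n. \<alpha> n * upper_dini (h n) xh u) \<ge> 0)"

end

theory Submission
  imports Defs
begin

text \<open>
  If the first alternative fails, then \<open>0 \<le> max (D\<^sup>+h\<^sub>n(u) + s h\<^sub>n(xh))\<close>, the maximum running over
  all \<open>n\<close> including \<open>\<infinity>\<close>, for every \<open>u\<close> and every \<open>s \<ge> 0\<close>: otherwise a short step from
  \<open>(xh, 0)\<close> in the direction \<open>(u, s)\<close> makes every \<open>h\<^sub>n(x) - (1 - t) h\<^sub>n(xh)\<close> uniformly negative,
  because the difference quotients converge as \<open>n \<rightarrow> \<infinity>\<close> uniformly in the step length. The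
  multipliers form a probability on the one-point compactification of the naturals; such
  probabilities are a compact convex set in the product topology, on which
  \<open>\<alpha> \<mapsto> \<Sum>\<alpha>\<^sub>n (D\<^sup>+h\<^sub>n(u) + s h\<^sub>n(xh))\<close> is continuous and affine. By compactness only finitely
  many pairs \<open>(u, s)\<close> need to be treated at once. A failure for finitely many pairs is, by
  separation, a failure for a single nonnegative combination of these affine functions, and
  sublinearity turns this combination into a single pair.
\<close>

subsection \<open>A finite minimax theorem\<close>

text \<open>The image of \<open>K\<close> under \<open>(f, g)\<close> is compact, convex and
  disjoint from the closed quadrant, so a line separates the two strictly. The threshold is negative
  because the origin lies in the quadrant, and the normal has nonnegative entries because its
  functional is bounded below on the quadrant.\<close>

lemma two_function_alternative:
  fixes f g :: "'b::topological_space \<Rightarrow> real"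
  assumes "compact K" "continuous_on K f" "continuous_on K g"
    and conv: "convex ((\<lambda>x. (f x, g x)) ` K)"
    and none: "\<And>x. x \<in> K \<Longrightarrow> \<not> (0 \<le> f x \<and> 0 \<le> g x)"
  obtains a b where "0 \<le> a" "0 \<le> b" "\<And>x. x \<in> K \<Longrightarrow> a * f x + b * g x < 0"
proof (cases "K = {}")
  case True
  show thesis by (rule that[of 0 0]) (use True in auto)
next
  case False
  let ?S = "(\<lambda>x. (f x, g x)) ` K"
  let ?T = "{0..} \<times> {0..} :: (real \<times> real) set"
  have "compact ?S"
    using assms by (intro compact_continuous_image continuous_intros)
  moreover have "convex ?T" "closed ?T"
    by (auto intro: convex_Times closed_Times)
  moreover have "?S \<inter> ?T = {}"
    using none by auto
  ultimately have "\<exists>v c. (\<forall>z\<in>?S. inner v z < c) \<and> (\<forall>z\<in>?T. c < inner v z)"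
    using conv False by (intro separating_hyperplane_compact_closed) simp_all
  then obtain v c where v: "\<And>z. z \<in> ?S \<Longrightarrow> inner v z < c" "\<And>z. z \<in> ?T \<Longrightarrow> c < inner v z"
    by blast
  obtain a b where ab: "v = (a, b)" by (cases v)
  have c: "c < 0"
    using v(2)[of "(0, 0)"] ab by simp
  have a: "0 \<le> a"
  proof (rule ccontr)
    assume "\<not> 0 \<le> a"
    \<comment> \<open>For negative \<open>a\<close> the point \<open>(c / a, 0)\<close> lies in the
      quadrant, and the functional takes exactly the value \<open>c\<close> there.\<close>
    with c have "c < a * (c / a)"
      using v(2)[of "(c / a, 0)"] ab by (simp add: divide_nonpos_neg)
    with \<open>\<not> 0 \<le> a\<close> show False by simp
  qed
  have b: "0 \<le> b"
  proof (rule ccontr)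
    assume "\<not> 0 \<le> b"
    with c have "c < b * (c / b)"
      using v(2)[of "(0, c / b)"] ab by (simp add: divide_nonpos_neg)
    with \<open>\<not> 0 \<le> b\<close> show False by simp
  qed
  show thesis
    using v(1) c ab by (intro that[OF a b]) force
qed

text \<open>
  Convex combinations in \<open>K\<close> are given by an abstract operation \<open>mix\<close>, because \<open>nat \<Rightarrow> real\<close>
  carries no vector space structure in the library.
\<close>
lemma finite_minimax:
  fixes f :: "'i \<Rightarrow> 'b::topological_space \<Rightarrow> real"
    and mix :: "real \<Rightarrow> 'b \<Rightarrow> 'b \<Rightarrow> 'b"
  assumes "finite I" "compact K"
    and "\<And>t x y. \<lbrakk>x \<in> K; y \<in> K; 0 \<le> t; t \<le> 1\<rbrakk> \<Longrightarrow> mix t x y \<in> K"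
    and "\<And>i. i \<in> I \<Longrightarrow> continuous_on K (f i)"
    and "\<And>i t x y. \<lbrakk>i \<in> I; x \<in> K; y \<in> K; 0 \<le> t; t \<le> 1\<rbrakk> \<Longrightarrow>
           f i (mix t x y) = (1 - t) * f i x + t * f i y"
    and "\<And>x. x \<in> K \<Longrightarrow> \<exists>i\<in>I. f i x < 0"
  shows "\<exists>c. (\<forall>i\<in>I. 0 \<le> c i) \<and> (\<forall>x\<in>K. (\<Sum>i\<in>I. c i * f i x) < 0)"
  using assms
proof (induction I arbitrary: K rule: finite_induct)
  case empty
  \<comment> \<open>Without indices the last assumption forces \<open>K\<close> to be empty.\<close>
  then show ?case by auto
next
  case (insert k I)
  note mixK = insert.prems(2) and cont = insert.prems(3) and affine = insert.prems(4)
  \<comment> \<open>On \<open>?K'\<close> the index \<open>k\<close> is never the negative one, so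
    the induction hypothesis applies to \<open>I\<close> there. The resulting combination
    \<open>g\<close> is negative on \<open>?K'\<close>, hence \<open>f k\<close> and
    \<open>g\<close> are never both nonnegative on \<open>K\<close>.\<close>
  let ?K' = "{x \<in> K. 0 \<le> f k x}"
  have "compact ?K'"
  proof (rule closedin_compact[OF \<open>compact K\<close>])
    have "closedin (top_of_set K) (K \<inter> f k -` {0..})"
      using cont by (intro continuous_closedin_preimage) auto
    then show "closedin (top_of_set K) ?K'"
      by (simp add: vimage_def Collect_conj_eq)
  qed
  have "\<exists>c. (\<forall>i\<in>I. 0 \<le> c i) \<and> (\<forall>x\<in>?K'. (\<Sum>i\<in>I. c i * f i x) < 0)"
  proof (rule insert.IH)
    show "mix t x y \<in> ?K'" if "x \<in> ?K'" "y \<in> ?K'" "0 \<le> t" "t \<le> 1" for t x y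
      using that mixK[of x y t] affine[of k x y t] by simp
    show "continuous_on ?K' (f i)" if "i \<in> I" for i
      using that by (intro continuous_on_subset[OF cont]) auto
    show "f i (mix t x y) = (1 - t) * f i x + t * f i y"
      if "i \<in> I" "x \<in> ?K'" "y \<in> ?K'" "0 \<le> t" "t \<le> 1" for i t x y
      using affine[of i x y t] that by simp
    show "\<exists>i\<in>I. f i x < 0" if "x \<in> ?K'" for x
      using insert.prems(5)[of x] that by auto
  qed fact
  then obtain c where c: "\<And>i. i \<in> I \<Longrightarrow> 0 \<le> c i"
    and neg: "\<And>x. x \<in> ?K' \<Longrightarrow> (\<Sum>i\<in>I. c i * f i x) < 0"
    by blast
  define g where "g x = (\<Sum>i\<in>I. c i * f i x)" for x
  have g_affine: "g (mix t x y) = (1 - t) * g x + t * g y"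
    if "x \<in> K" "y \<in> K" "0 \<le> t" "t \<le> 1" for t x y
  proof -
    have "c i * f i (mix t x y) = (1 - t) * (c i * f i x) + t * (c i * f i y)" if "i \<in> I" for i
      using \<open>x \<in> K\<close> \<open>y \<in> K\<close> \<open>0 \<le> t\<close> \<open>t \<le> 1\<close> that
      by (subst affine) (auto simp: algebra_simps)
    then have "g (mix t x y) = (\<Sum>i\<in>I. (1 - t) * (c i * f i x) + t * (c i * f i y))"
      unfolding g_def by (intro sum.cong) auto
    then show ?thesis
      by (simp add: g_def sum.distrib sum_distrib_left)
  qed
  \<comment> \<open>Affinity sends \<open>mix\<close> to ordinary segments in the plane, where
    convexity makes sense.\<close>
  have "convex ((\<lambda>x. (f k x, g x)) ` K)"
    unfolding convex_alt
  proof (intro ballI allI impI)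
    fix z w and t :: real
    assume "z \<in> (\<lambda>x. (f k x, g x)) ` K" "w \<in> (\<lambda>x. (f k x, g x)) ` K" and t: "0 \<le> t \<and> t \<le> 1"
    then obtain x y where xy: "x \<in> K" "y \<in> K" "z = (f k x, g x)" "w = (f k y, g y)"
      by auto
    then have eq: "(1 - t) *\<^sub>R z + t *\<^sub>R w = (f k (mix t x y), g (mix t x y))"
      using t affine[of k x y t] g_affine[of x y t] by simp
    have "mix t x y \<in> K"
      using mixK[of x y t] xy t by simp
    then show "(1 - t) *\<^sub>R z + t *\<^sub>R w \<in> (\<lambda>x. (f k x, g x)) ` K"
      unfolding eq by (rule imageI)
  qed
  moreover have "continuous_on K g"
    unfolding g_def using cont by (intro continuous_intros) auto
  moreover have "\<not> (0 \<le> f k x \<and> 0 \<le> g x)" if "x \<in> K" for x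
    using neg[of x] that by (auto simp: g_def)
  ultimately obtain a b where ab: "0 \<le> a" "0 \<le> b" "\<And>x. x \<in> K \<Longrightarrow> a * f k x + b * g x < 0"
    using two_function_alternative[OF \<open>compact K\<close> cont[OF insertI1], of g] by blast
  let ?c = "\<lambda>i. if i = k then a else b * c i"
  have "(\<Sum>i\<in>insert k I. ?c i * f i x) = a * f k x + b * g x" for x
  proof -
    have "(\<Sum>i\<in>I. ?c i * f i x) = (\<Sum>i\<in>I. b * (c i * f i x))"
      using insert.hyps by (intro sum.cong) auto
    then show ?thesis
      using insert.hyps by (simp add: g_def sum_distrib_left)
  qed
  then have "\<forall>x\<in>K. (\<Sum>i\<in>insert k I. ?c i * f i x) < 0"
    using ab(3) by simp
  moreover have "\<forall>i\<in>insert k I. 0 \<le> ?c i"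
    using ab(1,2) c by simp
  ultimately show ?case
    by (intro exI[of _ ?c] conjI)
qed

subsection \<open>Averages of convergent sequences\<close>

text \<open>Each condition involves finitely many coordinates, so the set is closed in the product
  topology. Total mass exactly 1 would not be a closed condition, since mass can escape to
  infinity.\<close>

definition subweights :: "(nat \<Rightarrow> real) set" where
  "subweights = {\<alpha>. \<forall>n. 0 \<le> \<alpha> n \<and> (\<Sum>i<n. \<alpha> i) \<le> 1}"

lemma subweights_iff:
  "\<alpha> \<in> subweights \<longleftrightarrow> (\<forall>n. 0 \<le> \<alpha> n) \<and> summable \<alpha> \<and> suminf \<alpha> \<le> 1"
proof (intro iffI conjI)
  assume \<alpha>: "\<alpha> \<in> subweights"
  then show "\<forall>n. 0 \<le> \<alpha> n" by (simp add: subweights_def)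
  show "summable \<alpha>"
    using \<alpha> by (intro summableI_nonneg_bounded[of _ 1]) (auto simp: subweights_def)
  then show "suminf \<alpha> \<le> 1"
    using \<alpha> by (intro suminf_le_const) (auto simp: subweights_def)
next
  assume *: "(\<forall>n. 0 \<le> \<alpha> n) \<and> summable \<alpha> \<and> suminf \<alpha> \<le> 1"
  then have "(\<Sum>i<n. \<alpha> i) \<le> suminf \<alpha>" for n
    by (intro sum_le_suminf) auto
  with * show "\<alpha> \<in> subweights"
    by (auto simp: subweights_def intro: order_trans)
qed

text \<open>By Tychonoff the cube of sequences in [0,1] is compact, and the weights form a closed
  subset of it.\<close>

lemma compact_subweights: "compact subweights"
proof -
  have "compact (Pi\<^sub>E UNIV (\<lambda>_. {0..1}) :: (nat \<Rightarrow> real) set)"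
    using compactin_PiE[of "\<lambda>_. euclidean" UNIV "\<lambda>_::nat. {0..1::real}"]
    by (simp add: euclidean_product_topology)
  moreover have "closed subweights"
    unfolding subweights_def
    by (intro closed_Collect_all closed_Collect_conj closed_Collect_le continuous_intros
        continuous_on_product_coordinates)
  moreover have "subweights \<subseteq> Pi\<^sub>E UNIV (\<lambda>_. {0..1})"
  proof
    fix \<alpha> assume \<alpha>: "\<alpha> \<in> subweights"
    have "\<alpha> n \<le> 1" for n
    proof -
      have "(\<Sum>i<Suc n. \<alpha> i) \<le> 1" "0 \<le> (\<Sum>i<n. \<alpha> i)"
        using \<alpha> unfolding subweights_def by (blast intro: sum_nonneg)+
      then show ?thesis by simp
    qed
    with \<alpha> show "\<alpha> \<in> Pi\<^sub>E UNIV (\<lambda>_. {0..1})"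
      by (auto simp: subweights_def)
  qed
  ultimately show ?thesis
    by (metis compact_Int_closed inf.absorb2)
qed

lemma summable_weighted:
  fixes \<alpha> d :: "nat \<Rightarrow> real"
  assumes "\<And>n. 0 \<le> \<alpha> n" "summable \<alpha>" "convergent d"
  shows "summable (\<lambda>n. \<alpha> n * d n)"
proof -
  obtain B where B: "\<And>n. \<bar>d n\<bar> \<le> B"
    using convergent_imp_Bseq[OF \<open>convergent d\<close>] unfolding Bseq_def real_norm_def by blast
  show ?thesis
  proof (rule summable_comparison_test')
    show "summable (\<lambda>n. B * \<alpha> n)"
      using assms by (intro summable_mult)
    show "norm (\<alpha> n * d n) \<le> B * \<alpha> n" for n
      using mult_right_mono[OF B[of n] assms(1)[of n]] assms(1)[of n]
      by (simp add: abs_mult mult.commute)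
  qed
qed

text \<open>Partial sums are continuous, and a tail is at most the supremum of the tail of
  \<open>\<bar>d n\<bar>\<close> times a mass of at most 1, so they converge uniformly. The limit 0
  is essential: for constant \<open>d = 1\<close> the sum is the total mass, which jumps along unit
  weights moving to infinity.\<close>

lemma continuous_on_subweights:
  fixes d :: "nat \<Rightarrow> real"
  assumes "d \<longlonglongrightarrow> 0"
  shows "continuous_on subweights (\<lambda>\<alpha>. \<Sum>n. \<alpha> n * d n)"
proof (rule uniform_limit_theorem)
  show "\<forall>\<^sub>F N in sequentially. continuous_on subweights (\<lambda>\<alpha>. \<Sum>n<N. \<alpha> n * d n)"
    by (intro always_eventually allI continuous_intros
        continuous_on_subset[OF continuous_on_product_coordinates subset_UNIV])
  show "uniform_limit subweights (\<lambda>N \<alpha>. \<Sum>n<N. \<alpha> n * d n) (\<lambda>\<alpha>. \<Sum>n. \<alpha> n * d n) sequentially"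
  proof (rule uniform_limitI)
    fix e :: real assume "0 < e"
    then have "\<forall>\<^sub>F n in sequentially. \<bar>d n\<bar> < e / 2"
      using tendstoD[OF assms, of "e / 2"] by simp
    then obtain N where N: "\<And>n. N \<le> n \<Longrightarrow> \<bar>d n\<bar> < e / 2"
      by (auto simp: eventually_sequentially)
    have "dist (\<Sum>n<M. \<alpha> n * d n) (\<Sum>n. \<alpha> n * d n) < e"
      if "N \<le> M" "\<alpha> \<in> subweights" for M \<alpha>
    proof -
      have \<alpha>: "\<And>n. 0 \<le> \<alpha> n" "summable \<alpha>" "suminf \<alpha> \<le> 1"
        using that by (auto simp: subweights_iff)
      have sm: "summable (\<lambda>n. \<alpha> n * d n)"
        using \<alpha> assms by (intro summable_weighted) (auto simp: convergent_def)
      have le: "norm (\<alpha> (n + M) * d (n + M)) \<le> e / 2 * \<alpha> (n + M)" for n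
        using mult_right_mono[OF less_imp_le[OF N[of "n + M"]] \<alpha>(1)[of "n + M"]] that \<alpha>(1)[of "n + M"]
        by (simp add: abs_mult mult.commute)
      have sa: "summable (\<lambda>n. e / 2 * \<alpha> (n + M))"
        using \<alpha>(2) by (intro summable_mult) (simp add: summable_iff_shift)
      have "\<bar>\<Sum>n. \<alpha> (n + M) * d (n + M)\<bar> \<le> (\<Sum>n. e / 2 * \<alpha> (n + M))"
        using norm_suminf_le[OF le sa] by simp
      also have "\<dots> = e / 2 * (\<Sum>n. \<alpha> (n + M))"
        using \<alpha>(2) by (intro suminf_mult) (simp add: summable_iff_shift)
      also have "(\<Sum>n. \<alpha> (n + M)) \<le> 1"
        using suminf_split_initial_segment[OF \<alpha>(2), of M] \<alpha> sum_nonneg[of "{..<M}" \<alpha>] by simp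
      finally have "\<bar>\<Sum>n. \<alpha> (n + M) * d (n + M)\<bar> \<le> e / 2"
        using \<open>0 < e\<close> by simp
      then show ?thesis
        using suminf_split_initial_segment[OF sm, of M] \<open>0 < e\<close> by (simp add: dist_real_def)
    qed
    then show "\<forall>\<^sub>F M in sequentially. \<forall>\<alpha>\<in>subweights.
                 dist (\<Sum>n<M. \<alpha> n * d n) (\<Sum>n. \<alpha> n * d n) < e"
      unfolding eventually_sequentially by blast
  qed
qed simp

text \<open>
  A weight \<open>\<alpha>\<close> in \<^const>\<open>subweights\<close> stands for the probability on the one-point compactification of
  the naturals with mass \<open>1 - suminf \<alpha>\<close> at infinity; the expression in the conclusion is the integral
  of the convergent sequence \<open>c j\<close>.
\<close>
lemma convergent_sequences_alternative:
  fixes c :: "'j \<Rightarrow> nat \<Rightarrow> real" and cinf :: "'j \<Rightarrow> real"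
  assumes lim: "\<And>j. j \<in> J \<Longrightarrow> c j \<longlonglongrightarrow> cinf j"
    and cone: "\<And>I b. \<lbrakk>finite I; I \<subseteq> J; \<forall>j\<in>I. 0 \<le> b j; \<forall>n. (\<Sum>j\<in>I. b j * c j n) < 0\<rbrakk> \<Longrightarrow>
       0 \<le> (\<Sum>j\<in>I. b j * cinf j)"
  shows "\<exists>\<alpha>\<in>subweights. \<forall>j\<in>J. 0 \<le> cinf j + (\<Sum>n. \<alpha> n * (c j n - cinf j))"
proof -
  \<comment> \<open>Subtracting the limit leaves a null sequence, which is what continuity
    requires.\<close>
  define F where "F j \<alpha> = cinf j + (\<Sum>n. \<alpha> n * (c j n - cinf j))" for j \<alpha>
  have diff0: "(\<lambda>n. c j n - cinf j) \<longlonglongrightarrow> 0" if "j \<in> J" for j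
    using lim[OF that] by (simp add: LIM_zero)
  have cont: "continuous_on subweights (F j)" if "j \<in> J" for j
    unfolding F_def by (intro continuous_intros continuous_on_subweights diff0 that)
  have sm: "summable (\<lambda>n. \<alpha> n * (c j n - cinf j))" if "j \<in> J" "\<alpha> \<in> subweights" for j \<alpha>
    using that diff0[OF that(1)]
    by (intro summable_weighted) (auto simp: subweights_iff convergent_def)
  define mix :: "real \<Rightarrow> (nat \<Rightarrow> real) \<Rightarrow> (nat \<Rightarrow> real) \<Rightarrow> nat \<Rightarrow> real"
    where "mix t \<alpha> \<beta> n = (1 - t) * \<alpha> n + t * \<beta> n" for t \<alpha> \<beta> n
  have mix: "mix t \<alpha> \<beta> \<in> subweights"
    if "\<alpha> \<in> subweights" "\<beta> \<in> subweights" "0 \<le> t" "t \<le> 1" for t \<alpha> \<beta>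
  proof -
    have "(\<Sum>i<n. mix t \<alpha> \<beta> i) \<le> 1" for n
    proof -
      have "(\<Sum>i<n. mix t \<alpha> \<beta> i) = (1 - t) * (\<Sum>i<n. \<alpha> i) + t * (\<Sum>i<n. \<beta> i)"
        by (simp add: mix_def sum.distrib sum_distrib_left)
      also have "\<dots> \<le> 1"
        using that by (intro convex_bound_le) (auto simp: subweights_def)
      finally show ?thesis .
    qed
    with that show ?thesis
      by (auto simp: subweights_def mix_def)
  qed
  have affine: "F j (mix t \<alpha> \<beta>) = (1 - t) * F j \<alpha> + t * F j \<beta>"
    if "j \<in> J" "\<alpha> \<in> subweights" "\<beta> \<in> subweights" for j t \<alpha> \<beta>
  proof -
    have "(\<lambda>n. mix t \<alpha> \<beta> n * (c j n - cinf j)) sums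
        ((1 - t) * (\<Sum>n. \<alpha> n * (c j n - cinf j)) + t * (\<Sum>n. \<beta> n * (c j n - cinf j)))"
      using sums_add[OF sums_mult[OF summable_sums[OF sm[OF that(1,2)]], of "1 - t"]
          sums_mult[OF summable_sums[OF sm[OF that(1,3)]], of t]]
      by (simp add: mix_def algebra_simps)
    then show ?thesis
      by (simp add: F_def sums_iff algebra_simps)
  qed
  \<comment> \<open>The zero weight is the point mass at infinity and the unit weights are the point
    masses at the naturals; evaluating there recovers \<open>cinf j\<close> and
    \<open>c j n\<close>.\<close>
  have zero: "(\<lambda>_. 0) \<in> subweights"
    by (simp add: subweights_def)
  have unit: "(\<lambda>i. if i = n then 1 else 0) \<in> subweights" for n
    by (simp add: subweights_def)
  have F_unit: "F j (\<lambda>i. if i = n then 1 else 0) = c j n" for j n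
    using suminf_finite[of "{n}" "\<lambda>i. (if i = n then 1 else 0) * (c j i - cinf j)"]
    by (simp add: F_def)
  \<comment> \<open>Finite intersection property. A failure gives one nonnegative combination that
    is negative on all weights; its values at the point masses contradict
    \<open>cone\<close>.\<close>
  have fin: "subweights \<inter> \<Inter> ((\<lambda>j. {\<alpha> \<in> subweights. 0 \<le> F j \<alpha>}) ` I) \<noteq> {}"
    if I: "finite I" "I \<subseteq> J" for I
  proof
    assume "subweights \<inter> \<Inter> ((\<lambda>j. {\<alpha> \<in> subweights. 0 \<le> F j \<alpha>}) ` I) = {}"
    then have "\<exists>j\<in>I. F j \<alpha> < 0" if "\<alpha> \<in> subweights" for \<alpha>
      using that by (auto simp: set_eq_iff simp flip: not_le)
    then have "\<exists>b. (\<forall>j\<in>I. 0 \<le> b j) \<and> (\<forall>\<alpha>\<in>subweights. (\<Sum>j\<in>I. b j * F j \<alpha>) < 0)"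
    proof (intro finite_minimax[where mix = mix] compact_subweights)
      show "continuous_on subweights (F j)" if "j \<in> I" for j
        using cont I that by blast
      show "F j (mix t \<alpha> \<beta>) = (1 - t) * F j \<alpha> + t * F j \<beta>"
        if "j \<in> I" "\<alpha> \<in> subweights" "\<beta> \<in> subweights" for j t \<alpha> \<beta>
        using affine[of j \<alpha> \<beta> t] I that by blast
    qed (use I mix in auto)
    then obtain b where b: "\<forall>j\<in>I. 0 \<le> b j" "\<And>\<alpha>. \<alpha> \<in> subweights \<Longrightarrow> (\<Sum>j\<in>I. b j * F j \<alpha>) < 0"
      by blast
    have "(\<Sum>j\<in>I. b j * c j n) < 0" for n
      using b(2)[OF unit[of n]] by (simp add: F_unit)
    then have "0 \<le> (\<Sum>j\<in>I. b j * cinf j)"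
      using cone[of I b] I b(1) by simp
    moreover have "(\<Sum>j\<in>I. b j * cinf j) < 0"
      using b(2)[OF zero] by (simp add: F_def)
    ultimately show False by simp
  qed
  have "subweights \<inter> \<Inter> ((\<lambda>j. {\<alpha> \<in> subweights. 0 \<le> F j \<alpha>}) ` J) \<noteq> {}"
  proof (rule compact_imp_fip_image[OF compact_subweights])
    show "closed {\<alpha> \<in> subweights. 0 \<le> F j \<alpha>}" if "j \<in> J" for j
      using continuous_closed_preimage[OF cont[OF that] compact_imp_closed[OF compact_subweights]
          closed_atLeast[of 0]]
      by (simp add: vimage_def Collect_conj_eq)
  qed (use fin in blast)
  then obtain \<alpha> where "\<alpha> \<in> subweights" "\<forall>j\<in>J. 0 \<le> F j \<alpha>"
    by auto
  then show ?thesis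
    unfolding F_def by blast
qed

subsection \<open>Upper Dini derivatives and Gateaux derivatives\<close>

abbreviation diff_quot :: "('a::real_normed_vector \<Rightarrow> real) \<Rightarrow> 'a \<Rightarrow> 'a \<Rightarrow> real \<Rightarrow> real" where
  "diff_quot f x u t \<equiv> (f (x + t *\<^sub>R u) - f x) / t"

lemma eventually_add_scaleR_in_ball:
  fixes x u :: "'a::real_normed_vector"
  assumes "0 < \<rho>"
  shows "\<forall>\<^sub>F t in at (0::real). x + t *\<^sub>R u \<in> ball x \<rho>"
proof -
  have "((\<lambda>t::real. x + t *\<^sub>R u) \<longlongrightarrow> x + 0 *\<^sub>R u) (at 0)"
    by (intro tendsto_intros)
  then show ?thesis
    using assms by (intro topological_tendstoD[where l = x]) auto
qed

lemma eventually_at_right_add_scaleR_in_ball: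
  fixes x u :: "'a::real_normed_vector"
  assumes "0 < \<rho>"
  shows "\<forall>\<^sub>F t in at_right (0::real). x + t *\<^sub>R u \<in> ball x \<rho>"
  using eventually_add_scaleR_in_ball[OF assms, of x u] by (simp add: eventually_at_split)

lemma upper_dini_eqI:
  assumes "(diff_quot f x u \<longlongrightarrow> l) (at_right 0)"
  shows "upper_dini f x u = l"
proof -
  have "Limsup (at_right 0) (\<lambda>t. ereal (diff_quot f x u t)) = ereal l"
    using assms by (intro lim_imp_Limsup) auto
  then show ?thesis by (simp add: upper_dini_def)
qed

text \<open>Near 0 the difference quotients are bounded by \<open>L * norm u\<close>, so the upper
  limit is finite and survives the conversion to a real.\<close>

lemma ereal_upper_dini:
  fixes f :: "'a::real_normed_vector \<Rightarrow> real"
  assumes "L-lipschitz_on (ball x \<rho>) f" "0 < \<rho>"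
  shows "ereal (upper_dini f x u) = Limsup (at_right 0) (\<lambda>t. ereal (diff_quot f x u t))"
proof -
  let ?q = "\<lambda>t. ereal (diff_quot f x u t)"
  have ev: "\<forall>\<^sub>F t in at_right 0. \<bar>diff_quot f x u t\<bar> \<le> L * norm u"
    using eventually_at_right_add_scaleR_in_ball[OF \<open>0 < \<rho>\<close>, of x u] eventually_at_right_less[of 0]
  proof eventually_elim
    case (elim t)
    then have "\<bar>f (x + t *\<^sub>R u) - f x\<bar> \<le> L * (t * norm u)"
      using lipschitz_onD[OF assms(1), of "x + t *\<^sub>R u" x] \<open>0 < \<rho>\<close> by (simp add: dist_norm)
    with elim show ?case
      by (simp add: divide_le_eq mult_ac)
  qed
  have "Limsup (at_right 0) ?q \<le> ereal (L * norm u)"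
    by (rule Limsup_bounded, rule eventually_mono[OF ev]) (simp add: abs_le_iff del: abs_divide)
  moreover have "ereal (- (L * norm u)) \<le> Limsup (at_right 0) ?q"
    by (rule le_Limsup[OF _ eventually_mono[OF ev]]) (auto simp: abs_le_iff simp del: abs_divide)
  ultimately have "\<bar>Limsup (at_right 0) ?q\<bar> \<noteq> \<infinity>"
    by auto
  then show ?thesis
    by (simp add: upper_dini_def ereal_real)
qed

lemma upper_dini_lessD:
  fixes f :: "'a::real_normed_vector \<Rightarrow> real"
  assumes "L-lipschitz_on (ball x \<rho>) f" "0 < \<rho>" "upper_dini f x u < c"
  shows "\<forall>\<^sub>F t in at_right 0. diff_quot f x u t < c"
proof -
  have "Limsup (at_right 0) (\<lambda>t. ereal (diff_quot f x u t)) < ereal c"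
    using assms(3) by (simp flip: ereal_upper_dini[OF assms(1,2)])
  from Limsup_lessD[OF this] show ?thesis by simp
qed

lemma upper_dini_diff_le:
  fixes f g :: "'a::real_normed_vector \<Rightarrow> real"
  assumes f: "L-lipschitz_on (ball x \<rho>) f" and g: "M-lipschitz_on (ball x \<rho>) g" and "0 < \<rho>"
    and fg: "\<And>y. y \<in> ball x \<rho> \<Longrightarrow> \<bar>(f y - g y) - (f x - g x)\<bar> \<le> e * norm (y - x)"
  shows "\<bar>upper_dini f x u - upper_dini g x u\<bar> \<le> e * norm u"
proof -
  \<comment> \<open>Stated for arbitrary \<open>f\<close> and \<open>g\<close>, so that exchanging
    them yields the bound on the absolute value.\<close>
  have *: "upper_dini f x u \<le> upper_dini g x u + e * norm u"
    if f: "L-lipschitz_on (ball x \<rho>) f" and g: "M-lipschitz_on (ball x \<rho>) g"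
      and fg: "\<And>y. y \<in> ball x \<rho> \<Longrightarrow> \<bar>(f y - g y) - (f x - g x)\<bar> \<le> e * norm (y - x)"
    for f g :: "'a \<Rightarrow> real" and L M
  proof (rule field_le_epsilon)
    fix d :: real assume "0 < d"
    then have "\<forall>\<^sub>F t in at_right 0. diff_quot g x u t < upper_dini g x u + d"
      by (intro upper_dini_lessD[OF g \<open>0 < \<rho>\<close>]) simp
    then have "\<forall>\<^sub>F t in at_right 0. ereal (diff_quot f x u t) \<le> ereal (upper_dini g x u + e * norm u + d)"
      using eventually_at_right_add_scaleR_in_ball[OF \<open>0 < \<rho>\<close>, of x u] eventually_at_right_less[of 0]
    proof eventually_elim
      case (elim t)
      have "f (x + t *\<^sub>R u) - f x \<le> (g (x + t *\<^sub>R u) - g x) + t * (e * norm u)"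
        using fg[OF elim(2)] elim(3) by (simp add: mult_ac)
      also have "\<dots> = t * (diff_quot g x u t + e * norm u)"
        using elim(3) by (simp add: distrib_left)
      finally have "diff_quot f x u t \<le> diff_quot g x u t + e * norm u"
        using elim(3) by (simp add: pos_divide_le_eq mult.commute)
      with elim(1) show ?case by simp
    qed
    then have "Limsup (at_right 0) (\<lambda>t. ereal (diff_quot f x u t)) \<le> ereal (upper_dini g x u + e * norm u + d)"
      by (rule Limsup_bounded)
    then show "upper_dini f x u \<le> upper_dini g x u + e * norm u + d"
      by (simp flip: ereal_upper_dini[OF f \<open>0 < \<rho>\<close>])
  qed
  have "\<bar>(g y - f y) - (g x - f x)\<bar> \<le> e * norm (y - x)" if "y \<in> ball x \<rho>" for y
    using fg[OF that] by linarith
  with *[OF f g fg] *[OF g f] show ?thesis by force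
qed

lemma has_gateaux_derivative_upper_dini:
  assumes "has_gateaux_derivative f D x"
  shows "upper_dini f x u = D u"
  using assms unfolding has_gateaux_derivative_def
  by (intro upper_dini_eqI) (simp add: filterlim_at_split)

text \<open>Any Gateaux derivative coincides with the upper Dini derivative, which depends on
  \<open>f\<close> alone; this makes the definite description meaningful.\<close>

lemma gateaux_derivative_eq:
  assumes "has_gateaux_derivative f D x"
  shows "gateaux_derivative f x = D"
  unfolding gateaux_derivative_def
proof (rule the_equality, rule assms)
  show "D' = D" if "has_gateaux_derivative f D' x" for D'
    using has_gateaux_derivative_upper_dini[OF that] has_gateaux_derivative_upper_dini[OF assms]
    by (intro ext) simp
qed

lemma gateaux_derivative_eq_upper_dini:
  assumes "gateaux_differentiable f x"
  shows "gateaux_derivative f x = upper_dini f x"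
proof -
  obtain D where D: "has_gateaux_derivative f D x"
    using assms by (auto simp: gateaux_differentiable_def)
  show ?thesis
    by (intro ext) (simp add: gateaux_derivative_eq[OF D] has_gateaux_derivative_upper_dini[OF D])
qed

lemma linear_upper_dini:
  assumes "gateaux_differentiable f x"
  shows "linear (upper_dini f x)"
proof -
  obtain D where D: "has_gateaux_derivative f D x"
    using assms by (auto simp: gateaux_differentiable_def)
  have "upper_dini f x = D"
    using has_gateaux_derivative_upper_dini[OF D] by blast
  with D show ?thesis
    by (simp add: has_gateaux_derivative_def bounded_linear.linear)
qed

section \<open>Sublinear and linear functionals and their pointwise limits\<close>

lemma sublinear_sum:
  assumes "sublinear p" "finite I" "\<And>i. i \<in> I \<Longrightarrow> 0 \<le> b i"
  shows "p (\<Sum>i\<in>I. b i *\<^sub>R v i) \<le> (\<Sum>i\<in>I. b i * p (v i))"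
  using assms(2,3)
proof (induction I rule: finite_induct)
  case empty
  have "p (0 *\<^sub>R 0) = 0 * p 0"
    using assms(1) unfolding sublinear_def by blast
  then show ?case by simp
next
  case (insert k I)
  have "p (b k *\<^sub>R v k + (\<Sum>i\<in>I. b i *\<^sub>R v i)) \<le> p (b k *\<^sub>R v k) + p (\<Sum>i\<in>I. b i *\<^sub>R v i)"
    using assms(1) by (simp add: sublinear_def)
  moreover have "p (b k *\<^sub>R v k) = b k * p (v k)"
    using assms(1) insert.prems by (simp add: sublinear_def)
  ultimately show ?case
    using insert by fastforce
qed

text \<open>Carries sublinearity, which property (H) states for the \<open>h n\<close>, over to the
  derivative of the limit function.\<close>

lemma sublinear_limit:
  assumes "\<And>n. sublinear (p n)" "\<And>u. (\<lambda>n. p n u) \<longlonglongrightarrow> q u"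
  shows "sublinear q"
  unfolding sublinear_def
proof (intro conjI allI impI)
  show "q (x + y) \<le> q x + q y" for x y
    using assms by (intro LIMSEQ_le[OF assms(2) tendsto_add[OF assms(2) assms(2)]])
      (auto simp: sublinear_def)
  show "q (c *\<^sub>R x) = c * q x" if "0 \<le> c" for c x
  proof (rule LIMSEQ_unique[OF assms(2)])
    show "(\<lambda>n. p n (c *\<^sub>R x)) \<longlonglongrightarrow> c * q x"
      using tendsto_mult_left[OF assms(2), of c x] assms(1) that by (simp add: sublinear_def)
  qed
qed

lemma linear_limit:
  fixes p :: "nat \<Rightarrow> 'a::real_vector \<Rightarrow> real"
  assumes "\<And>n. linear (p n)" "\<And>u. (\<lambda>n. p n u) \<longlonglongrightarrow> q u"
  shows "linear q"
proof (rule linearI)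
  show "q (x + y) = q x + q y" for x y
    using tendsto_add[OF assms(2)[of x] assms(2)[of y]] assms(2)[of "x + y"] assms(1)
    by (simp add: linear_add LIMSEQ_unique)
  show "q (c *\<^sub>R x) = c *\<^sub>R q x" for c x
    using tendsto_mult_left[OF assms(2)[of x], of c] assms(2)[of "c *\<^sub>R x"] assms(1)
    by (simp add: linear_scale LIMSEQ_unique)
qed

subsection \<open>Limits in the local Lipschitz seminorm\<close>

text \<open>What property (H) gives on a ball of finite radius. Seminorm convergence enters only
  through increments from the centre, which is all that difference quotients at \<open>xh\<close>
  involve.\<close>

locale locally_lipschitz_limit =
  fixes xh :: "'a::real_normed_vector" and h :: "nat \<Rightarrow> 'a \<Rightarrow> real" and hinf :: "'a \<Rightarrow> real"
    and \<rho> :: real and L :: "nat \<Rightarrow> real" and M :: real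
  assumes radius_pos: "0 < \<rho>"
    and lipschitz: "\<And>n. (L n)-lipschitz_on (ball xh \<rho>) (h n)"
    and lipschitz_limit: "M-lipschitz_on (ball xh \<rho>) hinf"
    and increments_close: "\<And>e. 0 < e \<Longrightarrow> \<forall>\<^sub>F n in sequentially. \<forall>y\<in>ball xh \<rho>.
           \<bar>(h n y - hinf y) - (h n xh - hinf xh)\<bar> \<le> e * norm (y - xh)"
begin

lemma eventually_upper_dini_close:
  assumes "0 < e"
  shows "\<forall>\<^sub>F n in sequentially. \<forall>u. \<bar>upper_dini (h n) xh u - upper_dini hinf xh u\<bar> \<le> e * norm u"
  using increments_close[OF assms]
  by eventually_elim (auto intro: upper_dini_diff_le[OF lipschitz lipschitz_limit radius_pos])

lemma upper_dini_tendsto: "(\<lambda>n. upper_dini (h n) xh u) \<longlonglongrightarrow> upper_dini hinf xh u"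
proof (rule tendstoI)
  fix e :: real assume "0 < e"
  \<comment> \<open>The summand 1 keeps the denominator positive when \<open>u = 0\<close>.\<close>
  define d where "d = e / (norm u + 1)"
  have "0 < norm u + 1"
    by (simp add: add_nonneg_pos)
  with \<open>0 < e\<close> have "0 < d" "d * norm u < e"
    by (auto simp: d_def field_simps)
  from eventually_upper_dini_close[OF \<open>0 < d\<close>]
  show "\<forall>\<^sub>F n in sequentially. dist (upper_dini (h n) xh u) (upper_dini hinf xh u) < e"
  proof eventually_elim
    case (elim n)
    then show ?case
      using \<open>d * norm u < e\<close> unfolding dist_real_def by (meson le_less_trans)
  qed
qed

text \<open>The increment bound scales with \<open>\<bar>t\<bar>\<close>, so one threshold for
  \<open>n\<close> serves all step lengths. Negative \<open>t\<close> are included for the two-sided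
  Gateaux limit.\<close>

lemma eventually_diff_quot_close:
  assumes "0 < e"
  shows "\<forall>\<^sub>F n in sequentially. \<forall>t. t \<noteq> 0 \<and> xh + t *\<^sub>R u \<in> ball xh \<rho> \<longrightarrow>
    \<bar>diff_quot (h n) xh u t - diff_quot hinf xh u t\<bar> \<le> e * norm u"
  using increments_close[OF assms]
proof eventually_elim
  case (elim n)
  show ?case
  proof (intro allI impI)
    fix t :: real assume t: "t \<noteq> 0 \<and> xh + t *\<^sub>R u \<in> ball xh \<rho>"
    let ?y = "xh + t *\<^sub>R u"
    have "diff_quot (h n) xh u t - diff_quot hinf xh u t = ((h n ?y - hinf ?y) - (h n xh - hinf xh)) / t"
      by (simp add: diff_divide_distrib)
    also have "\<bar>\<dots>\<bar> \<le> (e * norm (?y - xh)) / \<bar>t\<bar>"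
    proof -
      have "\<bar>(h n ?y - hinf ?y) - (h n xh - hinf xh)\<bar> \<le> e * norm (?y - xh)"
        using elim t by blast
      then show ?thesis
        unfolding abs_divide by (rule divide_right_mono) simp
    qed
    also have "\<dots> = e * norm u"
      using t by simp
    finally show "\<bar>diff_quot (h n) xh u t - diff_quot hinf xh u t\<bar> \<le> e * norm u" .
  qed
qed

text \<open>Linearity passes to the pointwise limit, and boundedness follows by comparison with a
  single \<open>h N\<close>. Convergence of the quotients is a three-epsilon argument through one
  fixed \<open>h n\<close>.\<close>

lemma has_gateaux_derivative_limit:
  assumes diff: "\<And>n. gateaux_differentiable (h n) xh"
  shows "has_gateaux_derivative hinf (upper_dini hinf xh) xh"
  unfolding has_gateaux_derivative_def
proof (intro conjI allI)
  let ?D = "\<lambda>n. upper_dini (h n) xh"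
  have D: "has_gateaux_derivative (h n) (?D n) xh" for n
    using diff[of n] has_gateaux_derivative_upper_dini unfolding gateaux_differentiable_def
    by (metis ext)
  have lin: "linear (upper_dini hinf xh)"
    using linear_limit[OF linear_upper_dini[OF diff] upper_dini_tendsto] .
  obtain N where N: "\<And>u. \<bar>?D N u - upper_dini hinf xh u\<bar> \<le> 1 * norm u"
    using eventually_happens'[OF _ eventually_upper_dini_close[of 1]] by auto
  obtain K where K: "\<And>u. norm (?D N u) \<le> norm u * K"
    using D[of N] bounded_linear.bounded unfolding has_gateaux_derivative_def by blast
  show "bounded_linear (upper_dini hinf xh)"
  proof (rule bounded_linear_intro)
    show "norm (upper_dini hinf xh u) \<le> norm u * (K + 1)" for u
      using N[of u] K[of u] by (simp add: distrib_left)
  qed (use lin in \<open>auto simp: linear_add linear_scale\<close>)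
  fix u
  show "(diff_quot hinf xh u \<longlongrightarrow> upper_dini hinf xh u) (at 0)"
  proof (rule tendstoI)
    fix e :: real assume "0 < e"
    define d where "d = e / (3 * (norm u + 1))"
    have "0 < norm u + 1"
      by (simp add: add_nonneg_pos)
    with \<open>0 < e\<close> have "0 < d" and du: "d * norm u < e / 3"
      by (auto simp: d_def field_simps)
    have "\<forall>\<^sub>F n in sequentially. \<bar>?D n u - upper_dini hinf xh u\<bar> \<le> d * norm u \<and>
        (\<forall>t. t \<noteq> 0 \<and> xh + t *\<^sub>R u \<in> ball xh \<rho> \<longrightarrow>
          \<bar>diff_quot (h n) xh u t - diff_quot hinf xh u t\<bar> \<le> d * norm u)"
      using eventually_upper_dini_close[OF \<open>0 < d\<close>] eventually_diff_quot_close[OF \<open>0 < d\<close>]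
      by eventually_elim blast
    then obtain n where n: "\<bar>?D n u - upper_dini hinf xh u\<bar> \<le> d * norm u"
        "\<And>t. \<lbrakk>t \<noteq> 0; xh + t *\<^sub>R u \<in> ball xh \<rho>\<rbrakk> \<Longrightarrow>
          \<bar>diff_quot (h n) xh u t - diff_quot hinf xh u t\<bar> \<le> d * norm u"
      using eventually_happens'[OF sequentially_bot] by blast
    have "(diff_quot (h n) xh u \<longlongrightarrow> ?D n u) (at 0)"
      using D[of n] unfolding has_gateaux_derivative_def by blast
    then have "\<forall>\<^sub>F t in at 0. dist (diff_quot (h n) xh u t) (?D n u) < e / 3"
      using \<open>0 < e\<close> by (intro tendstoD) auto
    then show "\<forall>\<^sub>F t in at 0. dist (diff_quot hinf xh u t) (upper_dini hinf xh u) < e"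
      using eventually_add_scaleR_in_ball[OF radius_pos, of xh u] eventually_neq_at_within[of 0 0 UNIV]
    proof eventually_elim
      case (elim t)
      then show ?case
        using n(1) n(2)[of t] du unfolding dist_real_def by linarith
    qed
  qed
qed

text \<open>How short a step must be depends on \<open>n\<close>. For large \<open>n\<close> the
  quotients follow those of \<open>hinf\<close>, so one condition on the step covers them all, and
  only finitely many \<open>n\<close> are treated individually.\<close>

lemma eventually_diff_quot_uniformly_negative:
  assumes lim: "(\<lambda>n. h n xh) \<longlonglongrightarrow> hinf xh"
    and neg: "\<And>n. upper_dini (h n) xh u + s * h n xh < 0"
    and neg_limit: "upper_dini hinf xh u + s * hinf xh < 0"
  obtains d where "0 < d" "\<forall>\<^sub>F t in at_right 0. \<forall>n. diff_quot (h n) xh u t + s * h n xh \<le> - d"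
proof -
  define A where "A = - (upper_dini hinf xh u + s * hinf xh)"
  have "0 < A" using neg_limit by (simp add: A_def)
  \<comment> \<open>The limit expression is \<open>- A\<close>. The finite step, the change of
    quotient and the change of value cost at most \<open>A / 4\<close> each, which leaves
    \<open>- A / 4\<close>.\<close>
  define e where "e = A / (4 * (norm u + 1))"
  have "0 < norm u + 1"
    by (simp add: add_nonneg_pos)
  with \<open>0 < A\<close> have "0 < e" and eu: "e * norm u < A / 4"
    by (auto simp: e_def field_simps)
  have "\<forall>\<^sub>F n in sequentially. dist (s * h n xh) (s * hinf xh) < A / 4"
    using tendsto_mult_left[OF lim, of s] \<open>0 < A\<close> by (intro tendstoD) auto
  with eventually_diff_quot_close[OF \<open>0 < e\<close>, of u]
  have "\<forall>\<^sub>F n in sequentially. (\<forall>t. t \<noteq> 0 \<and> xh + t *\<^sub>R u \<in> ball xh \<rho> \<longrightarrow>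
      \<bar>diff_quot (h n) xh u t - diff_quot hinf xh u t\<bar> \<le> e * norm u) \<and>
      dist (s * h n xh) (s * hinf xh) < A / 4"
    by (rule eventually_conj)
  then obtain N where N:
      "\<And>n t. \<lbrakk>N \<le> n; t \<noteq> 0; xh + t *\<^sub>R u \<in> ball xh \<rho>\<rbrakk> \<Longrightarrow>
        \<bar>diff_quot (h n) xh u t - diff_quot hinf xh u t\<bar> \<le> e * norm u"
      "\<And>n. N \<le> n \<Longrightarrow> \<bar>s * h n xh - s * hinf xh\<bar> < A / 4"
    unfolding eventually_sequentially dist_real_def by blast
  \<comment> \<open>Half of the negative gap is kept as margin, the other half is spent on the
    finite step.\<close>
  define b where "b n = - (upper_dini (h n) xh u + s * h n xh) / 2" for n
  define d where "d = Min (insert (A / 4) (b ` {..<N}))"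
  have b_pos: "0 < b n" for n
    using neg[of n] by (simp add: b_def)
  then have "0 < d"
    using \<open>0 < A\<close> by (simp add: d_def)
  have d_le: "d \<le> A / 4" "\<And>n. n < N \<Longrightarrow> d \<le> b n"
    unfolding d_def by (rule Min_le; simp)+
  have "\<forall>\<^sub>F t in at_right 0. diff_quot (h n) xh u t < - b n - s * h n xh" for n
    using neg[of n] by (intro upper_dini_lessD[OF lipschitz radius_pos]) (simp add: b_def field_simps)
  then have "\<forall>\<^sub>F t in at_right 0. \<forall>n\<in>{..<N}. diff_quot (h n) xh u t < - b n - s * h n xh"
    by (intro eventually_ball_finite) auto
  moreover have "\<forall>\<^sub>F t in at_right 0. diff_quot hinf xh u t < upper_dini hinf xh u + A / 4"
    using \<open>0 < A\<close> by (intro upper_dini_lessD[OF lipschitz_limit radius_pos]) simp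
  ultimately have "\<forall>\<^sub>F t in at_right 0. \<forall>n. diff_quot (h n) xh u t + s * h n xh \<le> - d"
    using eventually_at_right_add_scaleR_in_ball[OF radius_pos, of xh u] eventually_at_right_less[of 0]
  proof eventually_elim
    case (elim t)
    show ?case
    proof
      fix n
      show "diff_quot (h n) xh u t + s * h n xh \<le> - d"
      proof (cases "n < N")
        case True
        then have "diff_quot (h n) xh u t < - b n - s * h n xh"
          using elim(1) by blast
        with d_le(2)[OF True] show ?thesis by linarith
      next
        case False
        then have "\<bar>diff_quot (h n) xh u t - diff_quot hinf xh u t\<bar> \<le> e * norm u"
            "\<bar>s * h n xh - s * hinf xh\<bar> < A / 4"
          using N(1)[of n t] N(2)[of n] elim(3,4) by auto
        then show ?thesis
          using elim(2) d_le(1) eu A_def by linarith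
      qed
    qed
  qed
  with \<open>0 < d\<close> show thesis by (rule that)
qed

lemma multipliers_exist:
  assumes sub: "\<And>n. sublinear (upper_dini (h n) xh)"
    and lim: "(\<lambda>n. h n xh) \<longlonglongrightarrow> hinf xh"
    and none: "\<And>x t. \<lbrakk>x \<in> ball xh \<rho>; 0 \<le> t; t \<le> 1\<rbrakk> \<Longrightarrow>
      0 \<le> (SUP n. ereal (h n x - (1 - t) * h n xh))"
  shows "\<exists>\<alpha>inf \<alpha>. multipliers xh h hinf \<alpha>inf \<alpha>"
proof -
  \<comment> \<open>For \<open>j = (u, s)\<close> this is the upper Dini derivative of
    \<open>h n x - (1 - t) * h n xh\<close>, as a function of \<open>(x, t)\<close>, at
    \<open>(xh, 0)\<close> in direction \<open>(u, s)\<close>.\<close>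
  define c where "c j n = upper_dini (h n) xh (fst j) + snd j * h n xh" for j :: "'a \<times> real" and n
  define cinf where "cinf j = upper_dini hinf xh (fst j) + snd j * hinf xh" for j :: "'a \<times> real"
  have sub_limit: "sublinear (upper_dini hinf xh)"
    using sublinear_limit[OF sub upper_dini_tendsto] .
  have c_lim: "c j \<longlonglongrightarrow> cinf j" for j
    unfolding c_def cinf_def by (intro tendsto_intros upper_dini_tendsto lim)
  have "\<exists>\<alpha>\<in>subweights. \<forall>j\<in>UNIV \<times> {0..}. 0 \<le> cinf j + (\<Sum>n. \<alpha> n * (c j n - cinf j))"
  proof (rule convergent_sequences_alternative)
    fix I :: "('a \<times> real) set" and b
    assume I: "finite I" "I \<subseteq> UNIV \<times> {0..}" and b: "\<forall>j\<in>I. 0 \<le> b j"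
      and neg: "\<forall>n. (\<Sum>j\<in>I. b j * c j n) < 0"
    define u where "u = (\<Sum>j\<in>I. b j *\<^sub>R fst j)"
    define s where "s = (\<Sum>j\<in>I. b j * snd j)"
    have "0 \<le> s"
      unfolding s_def using I b by (intro sum_nonneg mult_nonneg_nonneg) auto
    \<comment> \<open>Sublinearity replaces the whole combination by the single pair
      \<open>(u, s)\<close>.\<close>
    have le: "p u + s * a \<le> (\<Sum>j\<in>I. b j * (p (fst j) + snd j * a))" if "sublinear p" for p a
      using sublinear_sum[OF that I(1), of b fst] b
      by (simp add: u_def s_def distrib_left sum.distrib sum_distrib_right mult.assoc)
    show "0 \<le> (\<Sum>j\<in>I. b j * cinf j)"
    proof (rule ccontr)
      assume "\<not> 0 \<le> (\<Sum>j\<in>I. b j * cinf j)"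
      then have "upper_dini hinf xh u + s * hinf xh < 0"
        using le[OF sub_limit, of "hinf xh"] by (simp add: cinf_def)
      moreover have "upper_dini (h n) xh u + s * h n xh < 0" for n
        using le[OF sub, of n "h n xh"] neg by (auto simp: c_def intro: le_less_trans)
      ultimately obtain d where "0 < d"
        and d: "\<forall>\<^sub>F t in at_right 0. \<forall>n. diff_quot (h n) xh u t + s * h n xh \<le> - d"
        using eventually_diff_quot_uniformly_negative[OF lim, of u s] by blast
      have "((\<lambda>t. t * s) \<longlongrightarrow> 0 * s) (at_right 0)"
        by (intro tendsto_intros)
      then have "\<forall>\<^sub>F t in at_right 0. t * s < 1"
        by (intro order_tendstoD) auto
      with d have "\<forall>\<^sub>F t in at_right 0. (\<forall>n. diff_quot (h n) xh u t + s * h n xh \<le> - d) \<and>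
          t * s < 1 \<and> 0 < t \<and> xh + t *\<^sub>R u \<in> ball xh \<rho>"
        by (intro eventually_conj eventually_at_right_add_scaleR_in_ball radius_pos
            eventually_at_right_less)
      then obtain t where t: "\<And>n. diff_quot (h n) xh u t + s * h n xh \<le> - d"
          "t * s < 1" "0 < t" "xh + t *\<^sub>R u \<in> ball xh \<rho>"
        using eventually_happens'[of "at_right (0::real)"] trivial_limit_at_right_real by blast
      \<comment> \<open>The bound must not depend on \<open>n\<close>: a supremum of negative
        numbers could still be 0.\<close>
      have "h n (xh + t *\<^sub>R u) - (1 - t * s) * h n xh \<le> - (t * d)" for n
      proof -
        have "h n (xh + t *\<^sub>R u) - (1 - t * s) * h n xh = t * (diff_quot (h n) xh u t + s * h n xh)"
          using t(3) by (simp add: distrib_left left_diff_distrib)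
        also have "\<dots> \<le> t * (- d)"
          using t(1,3) by (intro mult_left_mono) auto
        finally show ?thesis by simp
      qed
      then have "(SUP n. ereal (h n (xh + t *\<^sub>R u) - (1 - t * s) * h n xh)) \<le> ereal (- (t * d))"
        by (intro SUP_least) auto
      also have "\<dots> < 0"
        using \<open>0 < t\<close> \<open>0 < d\<close> by simp
      finally show False
        using none[OF t(4), of "t * s"] t(2,3) \<open>0 \<le> s\<close> by simp
    qed
  qed (rule c_lim)
  then obtain \<alpha> where \<alpha>: "\<alpha> \<in> subweights"
    and \<alpha>_nonneg: "\<And>u s. 0 \<le> s \<Longrightarrow> 0 \<le> cinf (u, s) + (\<Sum>n. \<alpha> n * (c (u, s) n - cinf (u, s)))"
    by auto
  have \<alpha>': "\<And>n. 0 \<le> \<alpha> n" "summable \<alpha>" "suminf \<alpha> \<le> 1"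
    using \<alpha> by (auto simp: subweights_iff)
  have sm: "summable (\<lambda>n. \<alpha> n * g n)" if "g \<longlonglongrightarrow> l" for g l
    using \<alpha>' that by (intro summable_weighted) (auto simp: convergent_def)
  \<comment> \<open>Splitting the series again turns the missing mass into the weight of the limit
    function.\<close>
  have average: "0 \<le> (1 - suminf \<alpha>) * cinf (u, s) + (\<Sum>n. \<alpha> n * c (u, s) n)" if "0 \<le> s" for u s
  proof -
    have "(\<Sum>n. \<alpha> n * (c (u, s) n - cinf (u, s))) =
        (\<Sum>n. \<alpha> n * c (u, s) n) - (\<Sum>n. \<alpha> n * cinf (u, s))"
      unfolding right_diff_distrib using sm[OF c_lim] sm[OF tendsto_const]
      by (rule suminf_diff[symmetric])
    also have "(\<Sum>n. \<alpha> n * cinf (u, s)) = suminf \<alpha> * cinf (u, s)"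
      using \<alpha>'(2) by (rule suminf_mult2[symmetric])
    finally show ?thesis
      using \<alpha>_nonneg[OF that, of u] by (simp add: left_diff_distrib)
  qed
  have zero: "p 0 = 0" if "sublinear p" for p :: "'a \<Rightarrow> real"
    using that unfolding sublinear_def by (metis mult_zero_left order_refl scaleR_zero_left)
  have "multipliers xh h hinf (1 - suminf \<alpha>) \<alpha>"
    unfolding multipliers_def
  proof (intro conjI allI)
    \<comment> \<open>The pair \<open>(0, 1)\<close> isolates the values, as sublinear functionals
      vanish at 0; the pairs \<open>(u, 0)\<close> isolate the derivatives.\<close>
    show "0 \<le> (1 - suminf \<alpha>) * hinf xh + (\<Sum>n. \<alpha> n * h n xh)"
      using average[of 1 0] by (simp add: c_def cinf_def zero[OF sub] zero[OF sub_limit])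
    show "0 \<le> (1 - suminf \<alpha>) * upper_dini hinf xh u + (\<Sum>n. \<alpha> n * upper_dini (h n) xh u)" for u
      using average[of 0 u] by (simp add: c_def cinf_def)
  qed (use \<alpha>' sm[OF lim] sm[OF upper_dini_tendsto] in auto)
  then show ?thesis by blast
qed

text \<open>If \<open>\<alpha> 0 = 0\<close>, all mass sits on indices where the derivative at
  \<open>w\<close> is at most some \<open>c < 0\<close>, infinity included by passing to the limit.
  The average is then at most \<open>c\<close>, against the third multiplier condition.\<close>

lemma multiplier_0_nonzero:
  assumes "multipliers xh h hinf \<alpha>inf \<alpha>"
    and neg: "(SUP n\<in>{1..}. ereal (upper_dini (h n) xh w)) < 0"
  shows "\<alpha> 0 \<noteq> 0"
proof
  assume "\<alpha> 0 = 0"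
  have m: "0 \<le> \<alpha>inf" "\<And>n. 0 \<le> \<alpha> n" "summable \<alpha>" "\<alpha>inf + suminf \<alpha> = 1"
      "summable (\<lambda>n. \<alpha> n * upper_dini (h n) xh w)"
      "0 \<le> \<alpha>inf * upper_dini hinf xh w + (\<Sum>n. \<alpha> n * upper_dini (h n) xh w)"
    using assms(1) unfolding multipliers_def by blast+
  obtain c where c: "(SUP n\<in>{1..}. ereal (upper_dini (h n) xh w)) < ereal c" "c < 0"
    using ereal_dense2[OF neg] by auto
  have le: "upper_dini (h n) xh w \<le> c" if "1 \<le> n" for n
  proof -
    have "ereal (upper_dini (h n) xh w) \<le> (SUP n\<in>{1..}. ereal (upper_dini (h n) xh w))"
      using that by (intro SUP_upper) auto
    then have "ereal (upper_dini (h n) xh w) \<le> ereal c"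
      using c(1) by (meson le_less_trans less_imp_le)
    then show ?thesis by simp
  qed
  then have "upper_dini hinf xh w \<le> c"
    by (intro LIMSEQ_le_const2[OF upper_dini_tendsto]) auto
  then have "\<alpha>inf * upper_dini hinf xh w \<le> \<alpha>inf * c"
    using m(1) by (rule mult_left_mono)
  moreover have "(\<Sum>n. \<alpha> n * upper_dini (h n) xh w) \<le> (\<Sum>n. \<alpha> n * c)"
  proof (rule suminf_le[OF _ m(5) summable_mult2[OF m(3)]])
    show "\<alpha> n * upper_dini (h n) xh w \<le> \<alpha> n * c" for n
      using \<open>\<alpha> 0 = 0\<close> le[of n] m(2)[of n] by (cases "n = 0") (auto intro: mult_left_mono)
  qed
  moreover have "\<alpha>inf * c + (\<Sum>n. \<alpha> n * c) = c"
    using m(4) by (simp add: suminf_mult2[OF m(3), symmetric] flip: distrib_right)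
  ultimately show False
    using m(6) \<open>c < 0\<close> by linarith
qed

text \<open>The derivatives are now linear, so the inequality at \<open>- u\<close> reverses the one
  at \<open>u\<close>.\<close>

lemma multipliers_gateaux:
  assumes mult: "multipliers xh h hinf \<alpha>inf \<alpha>"
    and diff: "\<And>n. gateaux_differentiable (h n) xh"
  shows "summable (\<lambda>n. \<alpha> n * gateaux_derivative (h n) xh u)"
    and "\<alpha>inf * gateaux_derivative hinf xh u + (\<Sum>n. \<alpha> n * gateaux_derivative (h n) xh u) = 0"
proof -
  have limit: "gateaux_differentiable hinf xh"
    using has_gateaux_derivative_limit[OF diff] by (auto simp: gateaux_differentiable_def)
  have m: "summable (\<lambda>n. \<alpha> n * upper_dini (h n) xh v)"
      "0 \<le> \<alpha>inf * upper_dini hinf xh v + (\<Sum>n. \<alpha> n * upper_dini (h n) xh v)" for v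
    using mult unfolding multipliers_def by blast+
  have "0 \<le> - (\<alpha>inf * upper_dini hinf xh u + (\<Sum>n. \<alpha> n * upper_dini (h n) xh u))"
    using m(2)[of "- u"] m(1)[of u]
    by (simp add: linear_neg[OF linear_upper_dini[OF diff]] linear_neg[OF linear_upper_dini[OF limit]]
        suminf_minus)
  with m(2)[of u] m(1)[of u]
  show "summable (\<lambda>n. \<alpha> n * gateaux_derivative (h n) xh u)"
    and "\<alpha>inf * gateaux_derivative hinf xh u + (\<Sum>n. \<alpha> n * gateaux_derivative (h n) xh u) = 0"
    by (simp_all add: gateaux_derivative_eq_upper_dini[OF diff] gateaux_derivative_eq_upper_dini[OF limit])
qed

end

section \<open>From property (H) to a ball, and the theorem\<close>

lemma lip_seminorm_lessD:
  assumes "lip_seminorm S f < ennreal e" "0 < e" "x \<in> S" "y \<in> S"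
  shows "\<bar>f x - f y\<bar> \<le> e * norm (x - y)"
proof (cases "x = y")
  case False
  have "ennreal (\<bar>f x - f y\<bar> / norm (x - y)) \<le> lip_seminorm S f"
    unfolding lip_seminorm_def using assms False
    by (intro SUP_upper2[of "(x, y)"]) auto
  also note assms(1)
  finally have "\<bar>f x - f y\<bar> / norm (x - y) < e"
    using \<open>0 < e\<close> by (simp add: ennreal_less_iff)
  with False show ?thesis
    by (simp add: divide_less_eq)
qed simp

lemma property_H_locally:
  assumes "open \<Omega>" "xh \<in> \<Omega>" "property_H \<Omega> xh h hinf"
  obtains \<rho> L M where "ball xh \<rho> \<subseteq> \<Omega>" "locally_lipschitz_limit xh h hinf \<rho> L M"
proof -
  obtain r :: ereal where "0 < r"
    and "\<forall>n. \<exists>L. L-lipschitz_on (eball xh r \<inter> \<Omega>) (h n)"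
    and hinf: "\<exists>L. L-lipschitz_on (eball xh r \<inter> \<Omega>) hinf"
    and lim: "(\<lambda>n. lip_seminorm (eball xh r \<inter> \<Omega>) (\<lambda>x. h n x - hinf x)) \<longlonglongrightarrow> 0"
    using assms(3) unfolding property_H_def by blast
  then obtain L where L: "\<And>n. (L n)-lipschitz_on (eball xh r \<inter> \<Omega>) (h n)"
    by metis
  obtain M where M: "M-lipschitz_on (eball xh r \<inter> \<Omega>) hinf"
    using hinf by blast
  \<comment> \<open>The radius \<open>r\<close> may be infinite, so a finite smaller one is
    chosen.\<close>
  obtain s :: real where s: "0 < s" "ereal s < r"
    using ereal_dense2[OF \<open>0 < r\<close>] by auto
  obtain d where d: "0 < d" "ball xh d \<subseteq> \<Omega>"
    using assms(1,2) open_contains_ball by blast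
  have sub: "ball xh (min s d) \<subseteq> eball xh r \<inter> \<Omega>"
  proof
    fix y assume y: "y \<in> ball xh (min s d)"
    then have "ereal (dist xh y) < ereal s" by simp
    with s(2) have "ereal (dist xh y) < r" by (rule less_trans[rotated])
    with y d show "y \<in> eball xh r \<inter> \<Omega>" by (auto simp: eball_def)
  qed
  have "locally_lipschitz_limit xh h hinf (min s d) L M"
  proof
    fix e :: real assume "0 < e"
    then have "\<forall>\<^sub>F n in sequentially. lip_seminorm (eball xh r \<inter> \<Omega>) (\<lambda>x. h n x - hinf x) < ennreal e"
      using lim by (intro order_tendstoD) auto
    then show "\<forall>\<^sub>F n in sequentially. \<forall>y\<in>ball xh (min s d).
        \<bar>(h n y - hinf y) - (h n xh - hinf xh)\<bar> \<le> e * norm (y - xh)"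
    proof eventually_elim
      case (elim n)
      have "xh \<in> ball xh (min s d)" using s d by simp
      with lip_seminorm_lessD[OF elim \<open>0 < e\<close>] sub show ?case by blast
    qed
  qed (use s d sub lipschitz_on_subset[OF L] lipschitz_on_subset[OF M] in auto)
  with sub show thesis
    by (intro that[of "min s d" L M]) auto
qed

theorem theorem1:
  fixes \<Omega> :: "'a::real_normed_vector set"
    and xh :: 'a
    and h :: "nat \<Rightarrow> 'a \<Rightarrow> real"
    and hinf :: "'a \<Rightarrow> real"
  assumes "open \<Omega>" and "\<Omega> \<noteq> {}" and "xh \<in> \<Omega>"
    and "property_H \<Omega> xh h hinf"
  shows "({(x, t) \<in> \<Omega> \<times> {0..1::real}.
             (SUP n. ereal (h n x - (1 - t) * h n xh)) < 0} \<noteq> {} \<or>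
          (\<exists>\<alpha>inf \<alpha>. multipliers xh h hinf \<alpha>inf \<alpha>)) \<and>
         (\<forall>\<alpha>inf \<alpha>. multipliers xh h hinf \<alpha>inf \<alpha> \<longrightarrow>
            ((\<exists>w. (SUP n\<in>{1..}. ereal (upper_dini (h n) xh w)) < 0) \<longrightarrow> \<alpha> 0 \<noteq> 0) \<and>
            ((\<forall>n. gateaux_differentiable (h n) xh) \<longrightarrow>
               gateaux_differentiable hinf xh \<and>
               (\<forall>u. summable (\<lambda>n. \<alpha> n * gateaux_derivative (h n) xh u) \<and>
                  \<alpha>inf * gateaux_derivative hinf xh u
                    + (\<Sum>n. \<alpha> n * gateaux_derivative (h n) xh u) = 0)))"
proof -
  obtain \<rho> L M where ball: "ball xh \<rho> \<subseteq> \<Omega>" and "locally_lipschitz_limit xh h hinf \<rho> L M"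
    using property_H_locally[OF \<open>open \<Omega>\<close> \<open>xh \<in> \<Omega>\<close> \<open>property_H \<Omega> xh h hinf\<close>]
    by blast
  interpret locally_lipschitz_limit xh h hinf \<rho> L M by fact
  let ?S = "{(x, t) \<in> \<Omega> \<times> {0..1::real}. (SUP n. ereal (h n x - (1 - t) * h n xh)) < 0}"
  have H: "\<And>n. sublinear (upper_dini (h n) xh)" "(\<lambda>n. h n xh) \<longlonglongrightarrow> hinf xh"
    using assms(4) unfolding property_H_def by blast+
  have "?S \<noteq> {} \<or> (\<exists>\<alpha>inf \<alpha>. multipliers xh h hinf \<alpha>inf \<alpha>)"
  proof (cases "?S = {}")
    case True
    \<comment> \<open>The failure of the first alternative is used only at points of the ball, where
      the Lipschitz estimates are available.\<close>
    then have "0 \<le> (SUP n. ereal (h n x - (1 - t) * h n xh))"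
      if "x \<in> ball xh \<rho>" "0 \<le> t" "t \<le> 1" for x t
      using that subsetD[OF ball that(1)] by (auto simp: set_eq_iff not_less)
    then have "\<exists>\<alpha>inf \<alpha>. multipliers xh h hinf \<alpha>inf \<alpha>"
      by (rule multipliers_exist[OF H])
    then show ?thesis ..
  qed simp
  moreover have "\<alpha> 0 \<noteq> 0"
    if "multipliers xh h hinf \<alpha>inf \<alpha>" "\<exists>w. (SUP n\<in>{1..}. ereal (upper_dini (h n) xh w)) < 0"
    for \<alpha>inf \<alpha>
    using multiplier_0_nonzero that by blast
  moreover have "gateaux_differentiable hinf xh" if "\<forall>n. gateaux_differentiable (h n) xh"
    unfolding gateaux_differentiable_def using has_gateaux_derivative_limit that by blast
  moreover have "summable (\<lambda>n. \<alpha> n * gateaux_derivative (h n) xh u) \<and>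
      \<alpha>inf * gateaux_derivative hinf xh u + (\<Sum>n. \<alpha> n * gateaux_derivative (h n) xh u) = 0"
    if "multipliers xh h hinf \<alpha>inf \<alpha>" "\<forall>n. gateaux_differentiable (h n) xh" for \<alpha>inf \<alpha> u
    using multipliers_gateaux[OF that(1), of u] that(2) by simp
  ultimately show ?thesis
    by simp
qed

end
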